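(* Let $\mathcal{X}\subset\mathbb{R}^n$ be Clarke regular, $g$ a continuous metric on $\mathcal{X}$, and $f:\mathcal{X}\to\mathbb{R}^n$ a continuous vector field. Then $\mathcal{S}_C(x_0)=\mathcal{S}_K(x_0)$ for all $x_0\in\mathcal{X}$, where $\mathcal{S}_C(x_0)$ and $\mathcal{S}_K(x_0)$ denote the sets of Carathéodory and Krasovskii solutions, respectively, of $\dot x\in\Pi_{\mathcal{X}}^{g}[f](x)$, $x(0)=x_0$.
   Context: Tangent cone: for $x\in\mathcal{X}$, $T_x\mathcal{X}$ is the set of all $v\in\mathbb{R}^n$ for which there exist $x_k\in\mathcal{X}$, $x_k\to x$, and $\delta_k\to 0^+$ with $(x_k-x)/\delta_k\to v$. Clarke tangent cone: $T^C_x\mathcal{X}:=\liminf_{y\to x}T_y\mathcal{X}$, i.e. the set of $v$ such that for every sequence $x_k\in\mathcal{X}$, $x_k\to x$, there are (for all large $k$) $v_k\in T_{x_k}\mathcal{X}$ with $v_k\to v$. $\mathcal{X}$ is Clarke regular if it is locally compact (the intersection of a closed and an open subset of $\mathbb{R}^n$) and $T_x\mathcal{X}=T_x^C\mathcal{X}$ for all $x\in\mathcal{X}$. Metric: a map $g$ assigning to every $x\in\mathcal{X}$ an inner product $\langle\cdot,\cdot\rangle_{g(x)}$ on $\mathbb{R}^n$, with norm $\|\cdot\|_{g(x)}$; it is continuous if it is continuous as a map into the space of bilinear forms on $\mathbb{R}^n$. Projected vector field (set-valued): $\Pi_{\mathcal{X}}^{g}[f](x):=\arg\min_{v\in T_x\mathcal{X}}\|v-f(x)\|^2_{g(x)}$.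 Krasovskii regularization of $F:\mathcal{X}\rightrightarrows\mathbb{R}^n$: $\mathrm{K}[F](x)$ is the closed convex hull of $\limsup_{y\to x}F(y)$, where the latter is the set of all $v$ for which there are $x_k\in\mathcal{X}$, $x_k\to x$, and $v_k\in F(x_k)$ with $v_k\to v$. $\mathcal{S}_C(x_0)$ (resp. $\mathcal{S}_K(x_0)$) is the set of absolutely continuous $x:[0,T)\to\mathcal{X}$, $T>0$, with $x(0)=x_0$ and $\dot x(t)\in\Pi_{\mathcal{X}}^{g}[f](x(t))$ (resp. $\dot x(t)\in\mathrm{K}[\Pi_{\mathcal{X}}^{g}[f]](x(t))$) for almost all $t\in[0,T)$. *)

theory Defs
  imports "HOL-Analysis.Analysis"
begin

text \<open>
  A set-valued map on \<open>X\<close> is a total function whose values outside \<open>X\<close> are never used.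
\<close>

definition outer_limit ::
  "(real^'n) set \<Rightarrow> (real^'n \<Rightarrow> (real^'n) set) \<Rightarrow> real^'n \<Rightarrow> (real^'n) set" where
  "outer_limit X F x =
    {v. \<exists>xs vs. (\<forall>k. xs k \<in> X) \<and> xs \<longlonglongrightarrow> x \<and> (\<forall>k. vs k \<in> F (xs k)) \<and> vs \<longlonglongrightarrow> v}"

definition inner_limit ::
  "(real^'n) set \<Rightarrow> (real^'n \<Rightarrow> (real^'n) set) \<Rightarrow> real^'n \<Rightarrow> (real^'n) set" where
  "inner_limit X F x =
    {v. \<forall>xs. (\<forall>k. xs k \<in> X) \<and> xs \<longlonglongrightarrow> x \<longrightarrow>
          (\<exists>vs. (\<forall>\<^sub>F k in sequentially. vs k \<in> F (xs k)) \<and> vs \<longlonglongrightarrow> v)}"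

definition tangent_cone :: "(real^'n) set \<Rightarrow> real^'n \<Rightarrow> (real^'n) set" where
  "tangent_cone X x =
    {v. \<exists>xs \<delta>. (\<forall>k. xs k \<in> X) \<and> xs \<longlonglongrightarrow> x \<and>
          (\<forall>k. \<delta> k > (0::real)) \<and> \<delta> \<longlonglongrightarrow> 0 \<and>
          (\<lambda>k. (xs k - x) /\<^sub>R \<delta> k) \<longlonglongrightarrow> v}"

definition clarke_tangent_cone :: "(real^'n) set \<Rightarrow> real^'n \<Rightarrow> (real^'n) set" where
  "clarke_tangent_cone X x = inner_limit X (tangent_cone X) x"

definition clarke_regular :: "(real^'n) set \<Rightarrow> bool" where
  "clarke_regular X \<longleftrightarrow>
    (\<exists>C U. closed C \<and> open U \<and> X = C \<inter> U) \<and>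
    (\<forall>x\<in>X. tangent_cone X x = clarke_tangent_cone X x)"

text \<open>
  Bilinear forms are bounded bilinear maps, with the operator norm topology; in finite
  dimension every bilinear form is of this kind.
\<close>

type_synonym 'n bilinear_form = "(real^'n) \<Rightarrow>\<^sub>L (real^'n) \<Rightarrow>\<^sub>L real"

definition inner_product_form :: "('n::finite) bilinear_form \<Rightarrow> bool" where
  "inner_product_form B \<longleftrightarrow>
    (\<forall>u v. blinfun_apply (blinfun_apply B u) v = blinfun_apply (blinfun_apply B v) u) \<and>
    (\<forall>v. v \<noteq> 0 \<longrightarrow> blinfun_apply (blinfun_apply B v) v > 0)"

definition form_norm :: "('n::finite) bilinear_form \<Rightarrow> real^'n \<Rightarrow> real" where
  "form_norm B v = sqrt (blinfun_apply (blinfun_apply B v) v)"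

definition metric_on :: "(real^'n) set \<Rightarrow> (real^'n \<Rightarrow> ('n::finite) bilinear_form) \<Rightarrow> bool" where
  "metric_on X g \<longleftrightarrow> (\<forall>x\<in>X. inner_product_form (g x))"

definition projected_field ::
  "(real^'n) set \<Rightarrow> (real^'n \<Rightarrow> ('n::finite) bilinear_form) \<Rightarrow> (real^'n \<Rightarrow> real^'n) \<Rightarrow>
   real^'n \<Rightarrow> (real^'n) set" where
  "projected_field X g f x =
    {v. is_arg_min (\<lambda>v. (form_norm (g x) (v - f x))\<^sup>2) (\<lambda>v. v \<in> tangent_cone X x) v}"

definition krasovskii ::
  "(real^'n) set \<Rightarrow> (real^'n \<Rightarrow> (real^'n) set) \<Rightarrow> real^'n \<Rightarrow> (real^'n) set" where
  "krasovskii X F x = closure (convex hull (outer_limit X F x))"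

definition abs_continuous_on :: "real set \<Rightarrow> (real \<Rightarrow> real^'n) \<Rightarrow> bool" where
  "abs_continuous_on I x \<longleftrightarrow>
    (\<forall>\<epsilon>>0. \<exists>\<delta>>0. \<forall>(m::nat) a b.
      (\<forall>i<m. a i \<le> b i \<and> {a i..b i} \<subseteq> I) \<and>
      disjoint_family_on (\<lambda>i. {a i<..<b i}) {..<m} \<and>
      (\<Sum>i<m. b i - a i) < \<delta>
      \<longrightarrow> (\<Sum>i<m. norm (x (b i) - x (a i))) < \<epsilon>)"

text \<open>
  A function \<open>[0,T) \<rightarrow> X\<close> is represented by the pair of \<open>T\<close> and a function that is
  \<open>undefined\<close> outside \<open>[0,T)\<close>, so that equal pairs are equal functions with equal domains.
\<close>

definition solutions ::
  "(real^'n) set \<Rightarrow> (real^'n \<Rightarrow> (real^'n) set) \<Rightarrow> real^'n \<Rightarrow> (real \<times> (real \<Rightarrow> real^'n)) set" where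
  "solutions X F x0 =
    {(T, x). 0 < T \<and> x \<in> {0..<T} \<rightarrow>\<^sub>E X \<and> abs_continuous_on {0..<T} x \<and> x 0 = x0 \<and>
       (AE t in lebesgue_on {0..<T}.
          \<exists>v\<in>F (x t). (x has_vector_derivative v) (at t within {0..<T}))}"

definition caratheodory_solutions ::
  "(real^'n) set \<Rightarrow> (real^'n \<Rightarrow> ('n::finite) bilinear_form) \<Rightarrow> (real^'n \<Rightarrow> real^'n) \<Rightarrow>
   real^'n \<Rightarrow> (real \<times> (real \<Rightarrow> real^'n)) set" where
  "caratheodory_solutions X g f x0 = solutions X (projected_field X g f) x0"

definition krasovskii_solutions ::
  "(real^'n) set \<Rightarrow> (real^'n \<Rightarrow> ('n::finite) bilinear_form) \<Rightarrow> (real^'n \<Rightarrow> real^'n) \<Rightarrow>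
   real^'n \<Rightarrow> (real \<times> (real \<Rightarrow> real^'n)) set" where
  "krasovskii_solutions X g f x0 = solutions X (krasovskii X (projected_field X g f)) x0"

end

theory Submission
  imports Defs
begin

text \<open>
  Along a curve in \<open>X\<close> the derivative is tangent to \<open>X\<close>, so it suffices to show that a
  tangent vector \<open>v\<close> in the Krasovskii regularization at \<open>x\<close> is the projection of
  \<open>f x\<close> onto the tangent cone \<open>T\<close> at \<open>x\<close>.

  By Clarke regularity \<open>T\<close> is closed under addition: if \<open>v\<close> is approximated by tangent
  vectors at all points near \<open>x\<close>, then \<open>t \<mapsto> d(y + t v, X)\<close> has a small lower Dini
  derivative, so \<open>d(y + t v, X) \<le> \<epsilon> t\<close> for \<open>y\<close> near \<open>x\<close> in \<open>X\<close>.
  Hence the projections \<open>w\<close> at nearby points satisfy \<open>\<langle>f - w, u\<rangle> \<le> 0\<close> for all tangent \<open>u\<close>,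
  and \<open>\<langle>f - w, w\<rangle> \<ge> 0\<close>. Since tangent vectors at \<open>x\<close> are limits of tangent vectors at nearby
  points, both conditions survive in the outer limit; they define closed convex sets of \<open>w\<close>,
  so they hold on the whole regularization, and for a tangent vector they characterize
  the projection.
\<close>

section \<open>Tangent cones of Clarke regular sets\<close>

text \<open>By compactness there is a last time at which \<open>\<phi> t \<le> c * t\<close>. Before
  \<open>a\<close>, the step hypothesis would produce a later one.\<close>

lemma lower_dini_bound:
  fixes \<phi> :: "real \<Rightarrow> real"
  assumes "0 \<le> a" and cont: "continuous_on {0..a} \<phi>" and "\<phi> 0 \<le> 0"
    and step: "\<And>t \<delta>. 0 \<le> t \<Longrightarrow> t < a \<Longrightarrow> 0 < \<delta> \<Longrightarrow> \<exists>h>0. h < \<delta> \<and> \<phi> (t + h) \<le> \<phi> t + c * h"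
  shows "\<phi> a \<le> c * a"
proof -
  define S where "S = {t \<in> {0..a}. \<phi> t - c * t \<le> 0}"
  have "closed S"
    unfolding S_def by (intro continuous_on_closed_Collect_le continuous_intros cont closed_atLeastAtMost)
  moreover have "bounded S"
    by (rule bounded_subset[of "{0..a}"]) (auto simp: S_def)
  ultimately have "compact S"
    by (simp add: compact_eq_bounded_closed)
  moreover have "S \<noteq> {}"
    using assms by (auto simp: S_def intro!: exI[of _ 0])
  ultimately obtain s where s: "s \<in> S" and max: "\<And>t. t \<in> S \<Longrightarrow> t \<le> s"
    using compact_attains_sup by metis
  have "s = a"
  proof (rule ccontr)
    assume "s \<noteq> a"
    then have "0 \<le> s" "s < a" using s by (auto simp: S_def)
    then obtain h where h: "0 < h" "h < a - s" "\<phi> (s + h) \<le> \<phi> s + c * h"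
      using step[of s "a - s"] by auto
    then have "s + h \<in> S"
      using s by (auto simp: S_def algebra_simps)
    then show False using max h by force
  qed
  then show ?thesis using s by (auto simp: S_def)
qed

text \<open>Bad points at distance below \<open>1 / (k + 1)\<close> for all \<open>k\<close> would
  form a sequence tending to \<open>x\<close> along which no selection tends to
  \<open>v\<close>.\<close>

lemma inner_limit_uniform:
  assumes "v \<in> inner_limit X F x" and "0 < \<epsilon>"
  shows "\<exists>\<eta>>0. \<forall>y\<in>X. dist y x < \<eta> \<longrightarrow> (\<exists>w\<in>F y. dist w v < \<epsilon>)"
proof (rule ccontr)
  assume "\<not> ?thesis"
  then have "\<forall>k. \<exists>y\<in>X. dist y x < inverse (real (Suc k)) \<and> (\<forall>w\<in>F y. \<not> dist w v < \<epsilon>)"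
    by (metis inverse_positive_iff_positive of_nat_0_less_iff zero_less_Suc)
  then obtain xs where xs: "\<And>k. xs k \<in> X" "\<And>k. dist (xs k) x < inverse (real (Suc k))"
    "\<And>k w. w \<in> F (xs k) \<Longrightarrow> \<not> dist w v < \<epsilon>"
    by metis
  have "xs \<longlonglongrightarrow> x"
    by (rule metric_tendsto_imp_tendsto[OF LIMSEQ_inverse_real_of_nat])
      (use xs(2) in \<open>auto simp: less_imp_le\<close>)
  then obtain vs where vs: "\<forall>\<^sub>F k in sequentially. vs k \<in> F (xs k)" "vs \<longlonglongrightarrow> v"
    using assms(1) xs(1) unfolding inner_limit_def by blast
  have "\<forall>\<^sub>F k in sequentially. dist (vs k) v < \<epsilon>"
    using vs(2) assms(2) by (rule tendstoD)
  with vs(1) have "\<forall>\<^sub>F k in sequentially. False"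
    by eventually_elim (use xs(3) in blast)
  then show False by simp
qed

lemma tangent_cone_infdist:
  assumes "w \<in> tangent_cone X z" and "X \<subseteq> C" and "0 < \<epsilon>" and "0 < \<delta>"
  shows "\<exists>h>0. h < \<delta> \<and> infdist (z + h *\<^sub>R w) C \<le> \<epsilon> * h"
proof -
  obtain xs d where xs: "\<And>k. xs k \<in> X" and d: "\<And>k. d k > (0::real)" "d \<longlonglongrightarrow> 0"
    and lim: "(\<lambda>k. (xs k - z) /\<^sub>R d k) \<longlonglongrightarrow> w"
    using assms(1) unfolding tangent_cone_def by blast
  have "\<forall>\<^sub>F k in sequentially. d k < \<delta> \<and> dist ((xs k - z) /\<^sub>R d k) w < \<epsilon>"
    using order_tendstoD(2)[OF d(2) assms(4)] tendstoD[OF lim assms(3)] by eventually_elim simp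
  from eventually_happens'[OF sequentially_bot this]
  obtain k where k: "d k < \<delta>" "dist ((xs k - z) /\<^sub>R d k) w < \<epsilon>"
    by blast
  have "infdist (z + d k *\<^sub>R w) C \<le> dist (z + d k *\<^sub>R w) (xs k)"
    using xs assms(2) by (intro infdist_le) auto
  also have "\<dots> = norm (d k *\<^sub>R ((xs k - z) /\<^sub>R d k - w))"
    using d(1)[of k] by (simp add: dist_norm norm_minus_commute algebra_simps)
  also have "\<dots> \<le> \<epsilon> * d k"
    using k(2) d(1)[of k] by (simp add: dist_norm)
  finally show ?thesis using k(1) d(1) by blast
qed

text \<open>Nearest points of \<open>C\<close> to \<open>x + h k *\<^sub>R v\<close> miss their
  targets by \<open>o(h k)\<close>, so their difference quotients tend to \<open>v\<close>. They
  converge to \<open>x\<close>, hence eventually lie in the open set \<open>U\<close> and thus in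
  \<open>X\<close>.\<close>

lemma tangent_coneI_infdist:
  fixes C :: "(real^'n) set"
  assumes X: "X = C \<inter> U" "closed C" "open U" and "x \<in> X"
    and h: "\<And>k. h k > (0::real)" "h \<longlonglongrightarrow> 0"
    and lim: "(\<lambda>k. infdist (x + h k *\<^sub>R v) C / h k) \<longlonglongrightarrow> 0"
  shows "v \<in> tangent_cone X x"
proof -
  have "C \<noteq> {}" using X \<open>x \<in> X\<close> by auto
  then have "\<forall>k. \<exists>z\<in>C. infdist (x + h k *\<^sub>R v) C = dist (x + h k *\<^sub>R v) z"
    using infdist_attains_inf[OF X(2)] by metis
  then obtain z where z: "\<And>k. z k \<in> C"
    "\<And>k. infdist (x + h k *\<^sub>R v) C = dist (x + h k *\<^sub>R v) (z k)"
    by metis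
  have quot: "(\<lambda>k. (z k - x) /\<^sub>R h k) \<longlonglongrightarrow> v"
  proof (rule metric_tendsto_imp_tendsto[OF lim], rule always_eventually, rule allI)
    fix k
    have "(z k - x) /\<^sub>R h k - v = (z k - (x + h k *\<^sub>R v)) /\<^sub>R h k"
      using h(1)[of k] by (simp add: algebra_simps)
    then have "dist ((z k - x) /\<^sub>R h k) v = dist (x + h k *\<^sub>R v) (z k) / h k"
      using h(1)[of k] by (simp add: dist_norm norm_minus_commute divide_inverse)
    then show "dist ((z k - x) /\<^sub>R h k) v \<le> dist (infdist (x + h k *\<^sub>R v) C / h k) 0"
      using z(2)[of k] h(1)[of k] by simp
  qed
  have "(\<lambda>k. x + h k *\<^sub>R ((z k - x) /\<^sub>R h k)) \<longlonglongrightarrow> x + 0 *\<^sub>R v"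
    by (intro tendsto_intros h quot)
  moreover have "x + h k *\<^sub>R ((z k - x) /\<^sub>R h k) = z k" for k
    using h(1)[of k] by simp
  ultimately have zx: "z \<longlonglongrightarrow> x" by simp
  have "\<forall>\<^sub>F k in sequentially. z k \<in> U"
    using topological_tendstoD[OF zx X(3)] X(1) \<open>x \<in> X\<close> by auto
  then obtain N where N: "\<And>k. k \<ge> N \<Longrightarrow> z k \<in> U"
    unfolding eventually_sequentially by blast
  show ?thesis
    \<comment> \<open>The definition asks for membership at every index, so the sequences are
      shifted past the first \<open>N\<close> terms.\<close>
    unfolding tangent_cone_def
  proof (intro CollectI exI conjI allI)
    show "z (k + N) \<in> X" for k using z(1) N X(1) by simp
    show "(\<lambda>k. z (k + N)) \<longlonglongrightarrow> x" using zx by (rule LIMSEQ_ignore_initial_segment)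
    show "h (k + N) > 0" for k by (rule h)
    show "(\<lambda>k. h (k + N)) \<longlonglongrightarrow> 0" using h(2) by (rule LIMSEQ_ignore_initial_segment)
    show "(\<lambda>k. (z (k + N) - x) /\<^sub>R h (k + N)) \<longlonglongrightarrow> v"
      using LIMSEQ_ignore_initial_segment[OF quot, of N] by simp
  qed
qed

text \<open>\<open>lower_dini_bound\<close> is applied to the distance from
  \<open>y + s *\<^sub>R v\<close> to \<open>C\<close>. From a nearest point \<open>z\<close>, a
  tangent vector \<open>w\<close> close to \<open>v\<close> is followed for a short time
  \<open>h\<close>: leaving \<open>C\<close> along \<open>w\<close> and replacing \<open>w\<close>
  by \<open>v\<close> cost at most \<open>\<epsilon> / 2 * h\<close> each.\<close>

lemma clarke_tangent_cone_infdist: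
  fixes C :: "(real^'n) set"
  assumes X: "X = C \<inter> U" "closed C" "open U" and "x \<in> X"
    and v: "v \<in> clarke_tangent_cone X x" and "0 < \<epsilon>"
  shows "\<exists>r>0. \<forall>y\<in>X. \<forall>t\<ge>0. dist y x < r \<and> t < r \<longrightarrow> infdist (y + t *\<^sub>R v) C \<le> \<epsilon> * t"
proof -
  obtain \<eta> where \<eta>: "\<eta> > 0"
    "\<And>y. y \<in> X \<Longrightarrow> dist y x < \<eta> \<Longrightarrow> \<exists>w\<in>tangent_cone X y. dist w v < \<epsilon> / 2"
    using inner_limit_uniform[of v X "tangent_cone X" x "\<epsilon> / 2"] v \<open>0 < \<epsilon>\<close>
    unfolding clarke_tangent_cone_def by auto
  obtain \<rho> where \<rho>: "\<rho> > 0" "ball x \<rho> \<subseteq> U"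
    using X \<open>x \<in> X\<close> open_contains_ball by (metis IntD2)
  \<comment> \<open>Points of \<open>C\<close> within \<open>m\<close> of \<open>x\<close> lie in
    \<open>X\<close> and have tangent vectors close to \<open>v\<close>. The choice of
    \<open>r\<close> keeps \<open>y + s *\<^sub>R v\<close> within \<open>m / 2\<close> of
    \<open>x\<close>; a nearest point in \<open>C\<close> is no farther away than \<open>x\<close>,
    hence within \<open>m\<close> of \<open>x\<close>.\<close>
  define m where "m = min \<eta> \<rho>"
  define r where "r = m / (2 * (1 + norm v))"
  have "m > 0" using \<eta> \<rho> by (simp add: m_def)
  have nv: "1 + norm v > 0" by (simp add: add_pos_nonneg)
  have "r > 0" using \<open>m > 0\<close> nv by (simp add: r_def)
  have r_eq: "r + r * norm v = m / 2"
  proof -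
    have "r + r * norm v = r * (1 + norm v)" by (simp add: algebra_simps)
    also have "\<dots> = m / 2"
      unfolding r_def using nv less_imp_neq[OF nv] by (simp add: divide_simps)
    finally show ?thesis .
  qed
  have "infdist (y + t *\<^sub>R v) C \<le> \<epsilon> * t"
    if y: "y \<in> X" "dist y x < r" and t: "0 \<le> t" "t < r" for y t
  proof (rule lower_dini_bound[OF t(1)])
    show "continuous_on {0..t} (\<lambda>t. infdist (y + t *\<^sub>R v) C)"
      by (intro continuous_intros)
    show "infdist (y + 0 *\<^sub>R v) C \<le> 0"
      using y X by simp
    fix s \<delta> :: real
    assume s: "0 \<le> s" "s < t" and "0 < \<delta>"
    let ?p = "y + s *\<^sub>R v"
    obtain z where z: "z \<in> C" "infdist ?p C = dist ?p z"
      using infdist_attains_inf[OF X(2)] X(1) y(1) by blast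
    have "s * norm v \<le> r * norm v"
      using s t by (intro mult_right_mono) auto
    moreover have "dist ?p x \<le> dist y x + s * norm v"
      using s norm_triangle_ineq[of "y - x" "s *\<^sub>R v"] by (simp add: dist_norm algebra_simps)
    ultimately have "dist ?p x < m / 2" using y(2) r_eq by linarith
    moreover have "dist ?p z \<le> dist ?p x"
      using z(2) infdist_le[of x C ?p] X(1) \<open>x \<in> X\<close> by simp
    ultimately have "dist z x < m"
      using dist_triangle3[of z x ?p] by linarith
    then have "z \<in> X" "dist z x < \<eta>"
      using \<rho>(2) z(1) X(1) by (auto simp: m_def dist_commute)
    then obtain w where w: "w \<in> tangent_cone X z" "dist w v < \<epsilon> / 2"
      using \<eta>(2) by blast
    obtain h where h: "h > 0" "h < \<delta>" "infdist (z + h *\<^sub>R w) C \<le> \<epsilon> / 2 * h"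
      using tangent_cone_infdist[OF w(1), of C "\<epsilon> / 2" \<delta>] X(1) \<open>0 < \<epsilon>\<close> \<open>0 < \<delta>\<close> by auto
    have eq: "y + (s + h) *\<^sub>R v - (z + h *\<^sub>R w) = (?p - z) + h *\<^sub>R (v - w)"
      by (simp add: algebra_simps)
    have "dist (y + (s + h) *\<^sub>R v) (z + h *\<^sub>R w) \<le> dist ?p z + h * dist v w"
      unfolding dist_norm eq using norm_triangle_ineq[of "?p - z" "h *\<^sub>R (v - w)"] h(1) by simp
    moreover have "h * dist v w \<le> h * (\<epsilon> / 2)"
      using h(1) w(2) by (intro mult_left_mono) (auto simp: dist_commute)
    moreover have "infdist (y + (s + h) *\<^sub>R v) C
        \<le> infdist (z + h *\<^sub>R w) C + dist (y + (s + h) *\<^sub>R v) (z + h *\<^sub>R w)"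
      by (rule infdist_triangle)
    ultimately have "infdist (y + (s + h) *\<^sub>R v) C \<le> infdist ?p C + \<epsilon> * h"
      using h(3) z(2) by (simp add: field_simps)
    then show "\<exists>h>0. h < \<delta> \<and> infdist (y + (s + h) *\<^sub>R v) C \<le> infdist ?p C + \<epsilon> * h"
      using h by blast
  qed
  then show ?thesis using \<open>r > 0\<close> by blast
qed

text \<open>If \<open>xs\<close> realizes \<open>u\<close>, then
  \<open>x + h k *\<^sub>R (u + v)\<close> is \<open>o(h k)\<close>-close to
  \<open>xs k + h k *\<^sub>R v\<close>. The latter is \<open>o(h k)\<close>-close to
  \<open>C\<close>, because the estimate for \<open>v\<close> is uniform in base points near
  \<open>x\<close>.\<close>

lemma tangent_cone_add_clarke:
  fixes X :: "(real^'n) set"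
  assumes X: "X = C \<inter> U" "closed C" "open U" and "x \<in> X"
    and u: "u \<in> tangent_cone X x" and v: "v \<in> clarke_tangent_cone X x"
  shows "u + v \<in> tangent_cone X x"
proof -
  obtain xs h where xs: "\<And>k. xs k \<in> X" "xs \<longlonglongrightarrow> x" and h: "\<And>k. h k > (0::real)" "h \<longlonglongrightarrow> 0"
    and lim: "(\<lambda>k. (xs k - x) /\<^sub>R h k) \<longlonglongrightarrow> u"
    using u unfolding tangent_cone_def by blast
  have "(\<lambda>k. infdist (x + h k *\<^sub>R (u + v)) C / h k) \<longlonglongrightarrow> 0"
  proof (rule tendstoI)
    fix e :: real assume "0 < e"
    obtain r where r: "r > 0" "\<And>y t. y \<in> X \<Longrightarrow> 0 \<le> t \<Longrightarrow> dist y x < r \<Longrightarrow> t < r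
        \<Longrightarrow> infdist (y + t *\<^sub>R v) C \<le> e / 2 * t"
      using clarke_tangent_cone_infdist[OF X \<open>x \<in> X\<close> v, of "e / 2"] \<open>0 < e\<close> by auto
    have "0 < e / 2" using \<open>0 < e\<close> by simp
    show "\<forall>\<^sub>F k in sequentially. dist (infdist (x + h k *\<^sub>R (u + v)) C / h k) 0 < e"
      using tendstoD[OF xs(2) r(1)] order_tendstoD(2)[OF h(2) r(1)] tendstoD[OF lim \<open>0 < e / 2\<close>]
    proof eventually_elim
      case (elim k)
      let ?q = "(xs k - x) /\<^sub>R h k"
      have hk: "h k > 0" by (rule h)
      have "x + h k *\<^sub>R (u + v) - (xs k + h k *\<^sub>R v) = h k *\<^sub>R (u - ?q)"
        using hk by (simp add: algebra_simps)
      then have "dist (x + h k *\<^sub>R (u + v)) (xs k + h k *\<^sub>R v) = h k * dist ?q u"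
        using hk by (simp add: dist_norm norm_minus_commute)
      moreover have "h k * dist ?q u < h k * (e / 2)"
        using hk elim(3) by (rule mult_strict_left_mono[rotated])
      moreover have "infdist (x + h k *\<^sub>R (u + v)) C \<le> infdist (xs k + h k *\<^sub>R v) C
          + dist (x + h k *\<^sub>R (u + v)) (xs k + h k *\<^sub>R v)"
        by (rule infdist_triangle)
      moreover have "infdist (xs k + h k *\<^sub>R v) C \<le> e / 2 * h k"
        using r(2) xs(1) hk elim by simp
      ultimately have "infdist (x + h k *\<^sub>R (u + v)) C < e * h k"
        by (simp add: field_simps)
      then show ?case
        using hk by (simp add: infdist_nonneg divide_less_eq)
    qed
  qed
  then show ?thesis
    by (rule tangent_coneI_infdist[OF X \<open>x \<in> X\<close> h])
qed

lemma tangent_cone_add: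
  assumes "clarke_regular X" and "x \<in> X" and "u \<in> tangent_cone X x" and "v \<in> tangent_cone X x"
  shows "u + v \<in> tangent_cone X x"
proof -
  obtain C U where "closed C" "open U" "X = C \<inter> U"
    using assms(1) unfolding clarke_regular_def by blast
  moreover have "v \<in> clarke_tangent_cone X x"
    using assms unfolding clarke_regular_def by blast
  ultimately show ?thesis
    using tangent_cone_add_clarke assms(2,3) by blast
qed

lemma tangent_cone_scaleR:
  assumes "v \<in> tangent_cone X x" and "0 < c"
  shows "c *\<^sub>R v \<in> tangent_cone X x"
proof -
  obtain xs d where xs: "\<And>k. xs k \<in> X" "xs \<longlonglongrightarrow> x" and d: "\<And>k. d k > (0::real)" "d \<longlonglongrightarrow> 0"
    and lim: "(\<lambda>k. (xs k - x) /\<^sub>R d k) \<longlonglongrightarrow> v"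
    using assms(1) unfolding tangent_cone_def by blast
  show ?thesis
    unfolding tangent_cone_def
  proof (intro CollectI exI conjI allI)
    show "xs k \<in> X" for k by (rule xs)
    show "d k / c > 0" for k using d assms by simp
    show "xs \<longlonglongrightarrow> x" by (rule xs)
    show "(\<lambda>k. d k / c) \<longlonglongrightarrow> 0" using tendsto_divide[OF d(2) tendsto_const[of c]] assms(2) by simp
    show "(\<lambda>k. (xs k - x) /\<^sub>R (d k / c)) \<longlonglongrightarrow> c *\<^sub>R v"
      using tendsto_scaleR[OF tendsto_const[of c] lim] by (simp add: divide_inverse mult.commute)
  qed
qed

section \<open>Velocities of curves in a set\<close>

text \<open>Only forward difference quotients are used; the half-open interval leaves room for them
  at every \<open>t\<close>, including \<open>t = 0\<close>.\<close>

lemma derivative_in_tangent_cone: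
  fixes x :: "real \<Rightarrow> real^'n"
  assumes t: "t \<in> {0..<T}" and x: "x ` {0..<T} \<subseteq> X"
    and der: "(x has_vector_derivative v) (at t within {0..<T})"
  shows "v \<in> tangent_cone X (x t)"
proof -
  \<comment> \<open>The factor \<open>1 / (k + 2)\<close> keeps \<open>t + d k\<close> strictly
    below \<open>T\<close> already for \<open>k = 0\<close>.\<close>
  define d where "d k = (T - t) * inverse (real (Suc (Suc k)))" for k
  have d_pos: "d k > 0" for k using t by (simp add: d_def)
  have "inverse (real (Suc (Suc k))) < 1" for k
    by (simp add: inverse_less_1_iff)
  then have d_less: "d k < T - t" for k
    using t mult_strict_left_mono[of "inverse (real (Suc (Suc k)))" 1 "T - t"] by (simp add: d_def)
  have d_lim: "d \<longlonglongrightarrow> 0"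
    using tendsto_mult[OF tendsto_const[of "T - t"] LIMSEQ_Suc[OF LIMSEQ_inverse_real_of_nat]]
    by (simp add: d_def[abs_def])
  have in_T: "t + d k \<in> {0..<T}" for k
    using t d_pos[of k] d_less[of k] by auto
  have "filterlim (\<lambda>k. t + d k) (at t within {0..<T}) sequentially"
    unfolding filterlim_at
  proof (intro conjI always_eventually allI)
    show "(\<lambda>k. t + d k) \<longlonglongrightarrow> t"
      using tendsto_add[OF tendsto_const[of t] d_lim] by simp
    show "t + d k \<in> {0..<T}" "t + d k \<noteq> t" for k
      using in_T[of k] d_pos[of k] by auto
  qed
  moreover have "((\<lambda>s. norm (x s - x t - (s - t) *\<^sub>R v) / norm (s - t)) \<longlongrightarrow> 0)
      (at t within {0..<T})"
    using der by (simp add: has_vector_derivative_def has_derivative_iff_norm)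
  ultimately have quot: "(\<lambda>k. norm (x (t + d k) - x t - d k *\<^sub>R v) / \<bar>d k\<bar>) \<longlonglongrightarrow> 0"
    by (auto dest: filterlim_compose)
  have lim: "(\<lambda>k. (x (t + d k) - x t) /\<^sub>R d k) \<longlonglongrightarrow> v"
  proof (rule metric_tendsto_imp_tendsto[OF quot], rule always_eventually, rule allI)
    fix k
    have "(x (t + d k) - x t) /\<^sub>R d k - v = (x (t + d k) - x t - d k *\<^sub>R v) /\<^sub>R d k"
      using d_pos[of k] by (simp add: algebra_simps)
    then show "dist ((x (t + d k) - x t) /\<^sub>R d k) v
        \<le> dist (norm (x (t + d k) - x t - d k *\<^sub>R v) / \<bar>d k\<bar>) 0"
      by (simp add: dist_norm divide_inverse)
  qed
  have "(\<lambda>k. x t + d k *\<^sub>R ((x (t + d k) - x t) /\<^sub>R d k)) \<longlonglongrightarrow> x t + 0 *\<^sub>R v"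
    by (intro tendsto_intros d_lim lim)
  moreover have "x t + d k *\<^sub>R ((x (t + d k) - x t) /\<^sub>R d k) = x (t + d k)" for k
    using d_pos[of k] by simp
  ultimately have "(\<lambda>k. x (t + d k)) \<longlonglongrightarrow> x t" by simp
  then show ?thesis
    unfolding tangent_cone_def
    by (intro CollectI exI[of _ "\<lambda>k. x (t + d k)"] exI[of _ d]) (use d_pos d_lim lim in_T x in auto)
qed

section \<open>Projections onto tangent cones\<close>

lemma inner_product_form_nonneg:
  assumes "inner_product_form B"
  shows "0 \<le> B v v"
  using assms unfolding inner_product_form_def by (cases "v = 0") (auto simp: less_imp_le)

lemma form_norm_square:
  assumes "inner_product_form B"
  shows "(form_norm B v)\<^sup>2 = B v v"
  using inner_product_form_nonneg[OF assms] by (simp add: form_norm_def)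

lemma form_add_square:
  assumes "inner_product_form B"
  shows "B (u + v) (u + v) = B u u + 2 * B u v + B v v"
proof -
  have "B v u = B u v" using assms unfolding inner_product_form_def by blast
  then show ?thesis by (simp add: blinfun.bilinear_simps)
qed

lemma projected_field_iff:
  assumes "inner_product_form (g x)"
  shows "v \<in> projected_field X g f x \<longleftrightarrow> v \<in> tangent_cone X x \<and>
    (\<forall>u\<in>tangent_cone X x. g x (v - f x) (v - f x) \<le> g x (u - f x) (u - f x))"
  unfolding projected_field_def is_arg_min_linorder form_norm_square[OF assms] by auto

text \<open>Expanding the square and dividing by \<open>s\<close> leaves
  \<open>2 * B a u + s * B u u\<close>, and \<open>s\<close> tends to 0 from the right.\<close>

lemma form_direction_nonneg:
  assumes B: "inner_product_form B"
    and min: "\<And>s. 0 < s \<Longrightarrow> s < 1 \<Longrightarrow> B a a \<le> B (a + s *\<^sub>R u) (a + s *\<^sub>R u)"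
  shows "0 \<le> B a u"
proof -
  have "((\<lambda>s. 2 * B a u + s * B u u) \<longlongrightarrow> 2 * B a u + 0 * B u u) (at_right 0)"
    by (intro tendsto_intros)
  moreover have "\<forall>\<^sub>F s::real in at_right 0. 0 < s \<and> s < 1"
    by (auto simp: eventually_at_right_field intro!: exI[of _ 1])
  then have "\<forall>\<^sub>F s in at_right 0. 0 \<le> 2 * B a u + s * B u u"
  proof eventually_elim
    case (elim s)
    then have "0 \<le> s * (2 * B a u + s * B u u)"
      using min[of s] form_add_square[OF B, of a "s *\<^sub>R u"]
      by (simp add: blinfun.scaleR_left blinfun.scaleR_right algebra_simps)
    then show ?case using elim by (simp add: zero_le_mult_iff)
  qed
  ultimately have "0 \<le> 2 * B a u + 0 * B u u"
    by (rule tendsto_lowerbound) simp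
  then show ?thesis by simp
qed

text \<open>First-order conditions for the minimizer, from perturbations that stay in the cone. The
  second is kept as an inequality because it then describes a convex set (a ball); equality would
  describe only its boundary sphere.\<close>

lemma projected_field_variational:
  assumes reg: "clarke_regular X" and x: "x \<in> X" and g: "inner_product_form (g x)"
    and w: "w \<in> projected_field X g f x"
  shows "u \<in> tangent_cone X x \<Longrightarrow> g x (f x - w) u \<le> 0" and "0 \<le> g x (f x - w) w"
proof -
  have wT: "w \<in> tangent_cone X x"
    and min: "\<And>u. u \<in> tangent_cone X x \<Longrightarrow> g x (w - f x) (w - f x) \<le> g x (u - f x) (u - f x)"
    using w unfolding projected_field_iff[of g x, OF g] by auto
  have dir: "0 \<le> g x (w - f x) u" if "\<And>s. 0 < s \<Longrightarrow> s < 1 \<Longrightarrow> w + s *\<^sub>R u \<in> tangent_cone X x" for u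
  proof (rule form_direction_nonneg[OF g])
    fix s :: real assume "0 < s" "s < 1"
    then show "g x (w - f x) (w - f x) \<le> g x (w - f x + s *\<^sub>R u) (w - f x + s *\<^sub>R u)"
      using min[OF that, of s] by (simp add: algebra_simps)
  qed
  show "g x (f x - w) u \<le> 0" if "u \<in> tangent_cone X x"
    using dir[of u] tangent_cone_add[OF reg x wT tangent_cone_scaleR[OF that]]
    by (simp add: blinfun.bilinear_simps)
  \<comment> \<open>The direction \<open>- w\<close> is admissible since
    \<open>w + s *\<^sub>R (- w)\<close> is the positive multiple
    \<open>(1 - s) *\<^sub>R w\<close>; this is why only \<open>s < 1\<close> is tested.\<close>
  have "w + s *\<^sub>R (- w) \<in> tangent_cone X x" if "0 < s" "s < 1" for s
    using tangent_cone_scaleR[OF wT, of "1 - s"] that by (simp add: algebra_simps)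
  from dir[OF this] show "0 \<le> g x (f x - w) w"
    by (simp add: blinfun.bilinear_simps)
qed

section \<open>Variational inequalities on the Krasovskii regularization\<close>

lemma outer_limit_projected_field_variational:
  fixes X :: "(real^'n) set"
  assumes reg: "clarke_regular X" and g: "metric_on X g" "continuous_on X g"
    and f: "continuous_on X f" and x: "x \<in> X"
    and w: "w \<in> outer_limit X (projected_field X g f) x"
  shows "u \<in> tangent_cone X x \<Longrightarrow> g x (f x - w) u \<le> 0" and "0 \<le> g x (f x - w) w"
proof -
  obtain xs ws where xs: "\<And>k. xs k \<in> X" "xs \<longlonglongrightarrow> x"
    and ws: "\<And>k. ws k \<in> projected_field X g f (xs k)" "ws \<longlonglongrightarrow> w"
    using w unfolding outer_limit_def by blast
  have form: "inner_product_form (g (xs k))" for k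
    using g(1) xs(1) unfolding metric_on_def by blast
  have gl: "(\<lambda>k. g (xs k)) \<longlonglongrightarrow> g x" and fl: "(\<lambda>k. f (xs k)) \<longlonglongrightarrow> f x"
    using g(2) f x xs unfolding continuous_on_sequentially by (auto simp: o_def)
  show "g x (f x - w) u \<le> 0" if "u \<in> tangent_cone X x"
  proof -
    \<comment> \<open>Regularity turns the fixed test vector \<open>u\<close> into test vectors
      \<open>us k\<close> at the moving base points, where the inequality is known.\<close>
    have "u \<in> inner_limit X (tangent_cone X) x"
      using reg x that unfolding clarke_regular_def clarke_tangent_cone_def by blast
    then obtain us where us: "\<forall>\<^sub>F k in sequentially. us k \<in> tangent_cone X (xs k)" "us \<longlonglongrightarrow> u"
      using xs unfolding inner_limit_def by blast
    have "(\<lambda>k. g (xs k) (f (xs k) - ws k) (us k)) \<longlonglongrightarrow> g x (f x - w) u"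
      by (intro blinfun.tendsto tendsto_diff gl fl ws us)
    moreover have "\<forall>\<^sub>F k in sequentially. g (xs k) (f (xs k) - ws k) (us k) \<le> 0"
      using us(1) by eventually_elim (rule projected_field_variational[OF reg xs(1) form ws(1)])
    ultimately show ?thesis by (rule tendsto_upperbound) simp
  qed
  have "(\<lambda>k. g (xs k) (f (xs k) - ws k) (ws k)) \<longlonglongrightarrow> g x (f x - w) w"
    by (intro blinfun.tendsto tendsto_diff gl fl ws)
  moreover have "\<forall>k. 0 \<le> g (xs k) (f (xs k) - ws k) (ws k)"
    using projected_field_variational(2)[OF reg xs(1) form ws(1)] by blast
  ultimately show "0 \<le> g x (f x - w) w"
    by (meson LIMSEQ_le_const)
qed

lemma closed_convex_affine_le:
  fixes L :: "(real^'n) \<Rightarrow>\<^sub>L real"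
  shows "closed {w. L w \<le> c}" and "convex {w. L w \<le> c}"
proof -
  show "closed {w. L w \<le> c}"
    by (intro closed_Collect_le continuous_intros)
  show "convex {w. L w \<le> c}"
  proof (rule convexI)
    fix a b :: "real^'n" and p q :: real
    assume "a \<in> {w. L w \<le> c}" "b \<in> {w. L w \<le> c}" "0 \<le> p" "0 \<le> q" "p + q = 1"
    then show "p *\<^sub>R a + q *\<^sub>R b \<in> {w. L w \<le> c}"
      using convex_bound_le[of "L a" c "L b" p q] by (simp add: blinfun.bilinear_simps)
  qed
qed

lemma krasovskii_subset:
  assumes "outer_limit X F x \<subseteq> S" and "closed S" and "convex S"
  shows "krasovskii X F x \<subseteq> S"
  unfolding krasovskii_def using assms by (intro closure_minimal hull_minimal)

lemma krasovskii_projected_field_variational: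
  fixes X :: "(real^'n) set"
  assumes reg: "clarke_regular X" and g: "metric_on X g" "continuous_on X g"
    and f: "continuous_on X f" and x: "x \<in> X"
    and v: "v \<in> krasovskii X (projected_field X g f) x"
  shows "u \<in> tangent_cone X x \<Longrightarrow> g x (f x - v) u \<le> 0" and "0 \<le> g x (f x - v) v"
proof -
  let ?B = "g x" and ?L = "outer_limit X (projected_field X g f) x"
  note outer = outer_limit_projected_field_variational[OF reg g f x]
  have B: "inner_product_form ?B" using g(1) x unfolding metric_on_def by blast
  then have sym: "?B a b = ?B b a" for a b unfolding inner_product_form_def by blast
  show "?B (f x - v) u \<le> 0" if "u \<in> tangent_cone X x"
  proof -
    \<comment> \<open>By symmetry of the form, the condition for fixed \<open>u\<close> is a
      half-space in \<open>w\<close>.\<close>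
    let ?S = "{w. (- ?B u) w \<le> - ?B u (f x)}"
    have "?L \<subseteq> ?S"
      using outer(1)[OF _ that] by (auto simp: blinfun.bilinear_simps sym[of u])
    then have "v \<in> ?S"
      using krasovskii_subset closed_convex_affine_le v by blast
    then show ?thesis by (simp add: blinfun.bilinear_simps sym[of u])
  qed
  \<comment> \<open>The ball \<open>\<langle>w, w\<rangle> \<le> \<langle>f x, w\<rangle>\<close> is the intersection over \<open>z\<close> of the half-spaces
      \<open>2 \<langle>z, w\<rangle> - \<langle>z, z\<rangle> \<le> \<langle>f x, w\<rangle>\<close>.\<close>
  have "v \<in> {w. (2 *\<^sub>R ?B z - ?B (f x)) w \<le> ?B z z}" (is "v \<in> ?S z") for z
  proof -
    have "?L \<subseteq> ?S z"
    proof
      fix w assume "w \<in> ?L"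
      then have "?B w w \<le> ?B (f x) w"
        using outer(2)[of w] by (simp add: blinfun.bilinear_simps)
      moreover have "0 \<le> ?B (z - w) (z - w)"
        by (rule inner_product_form_nonneg[OF B])
      ultimately show "w \<in> ?S z"
        by (simp add: blinfun.bilinear_simps sym[of w z])
    qed
    then show ?thesis
      using krasovskii_subset closed_convex_affine_le v by blast
  qed
  \<comment> \<open>For \<open>z = v\<close> the half-space inequality, evaluated at
    \<open>v\<close> itself, is already
    \<open>\<langle>v, v\<rangle> \<le> \<langle>f x, v\<rangle>\<close>.\<close>
  from this[of v] show "0 \<le> ?B (f x - v) v"
    by (simp add: blinfun.bilinear_simps)
qed

text \<open>The two inequalities add up to a nonnegative cross term in the expansion of the square
  around \<open>v\<close>. Tangency of \<open>v\<close> is a genuine restriction: at a boundary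
  point of a closed half-space, the projections at interior points tend to \<open>f x\<close>, which
  may point outward.\<close>

lemma krasovskii_tangent_imp_projected:
  fixes X :: "(real^'n) set"
  assumes reg: "clarke_regular X" and g: "metric_on X g" "continuous_on X g"
    and f: "continuous_on X f" and x: "x \<in> X"
    and v: "v \<in> krasovskii X (projected_field X g f) x" and vT: "v \<in> tangent_cone X x"
  shows "v \<in> projected_field X g f x"
proof -
  let ?B = "g x"
  have B: "inner_product_form ?B" using g(1) x unfolding metric_on_def by blast
  note var = krasovskii_projected_field_variational[OF reg g f x v]
  have "?B (v - f x) (v - f x) \<le> ?B (u - f x) (u - f x)" if "u \<in> tangent_cone X x" for u
  proof -
    have "?B (u - f x) (u - f x)
        = ?B (v - f x) (v - f x) + 2 * ?B (v - f x) (u - v) + ?B (u - v) (u - v)"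
      using form_add_square[OF B, of "v - f x" "u - v"] by simp
    moreover have "0 \<le> ?B (v - f x) (u - v)"
      using var(1)[OF that] var(2) by (simp add: blinfun.bilinear_simps)
    moreover have "0 \<le> ?B (u - v) (u - v)"
      by (rule inner_product_form_nonneg[OF B])
    ultimately show ?thesis by linarith
  qed
  then show ?thesis
    using vT by (simp add: projected_field_iff[of g x, OF B])
qed

section \<open>Equality of the solution sets\<close>

lemma subset_krasovskii:
  assumes "x \<in> X"
  shows "F x \<subseteq> krasovskii X F x"
proof
  fix v assume "v \<in> F x"
  then have "v \<in> outer_limit X F x"
    unfolding outer_limit_def using assms
    by (intro CollectI exI[of _ "\<lambda>_. x"] exI[of _ "\<lambda>_. v"]) auto
  then show "v \<in> krasovskii X F x"
    unfolding krasovskii_def by (meson closure_subset hull_subset subsetD)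
qed

theorem theorem5p3:
  fixes X :: "(real^'n) set"
    and g :: "real^'n \<Rightarrow> 'n bilinear_form"
    and f :: "real^'n \<Rightarrow> real^'n"
  assumes "clarke_regular X"
    and "metric_on X g" and "continuous_on X g"
    and "continuous_on X f"
  shows "\<forall>x0\<in>X. caratheodory_solutions X g f x0 = krasovskii_solutions X g f x0"
proof -
  \<comment> \<open>The equivalence holds at every \<open>t\<close>, with the same \<open>v\<close>
    on both sides: being a derivative of a curve in \<open>X\<close>, it is tangent.\<close>
  have "(\<exists>v\<in>projected_field X g f (x t). (x has_vector_derivative v) (at t within {0..<T}))
    \<longleftrightarrow> (\<exists>v\<in>krasovskii X (projected_field X g f) (x t).
          (x has_vector_derivative v) (at t within {0..<T}))"
    if x: "x \<in> {0..<T} \<rightarrow>\<^sub>E X" and t: "t \<in> {0..<T}" for x t T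
  proof -
    have "x t \<in> X" and "x ` {0..<T} \<subseteq> X" using x t by auto
    then show ?thesis
      using subset_krasovskii[OF \<open>x t \<in> X\<close>, of "projected_field X g f"]
        krasovskii_tangent_imp_projected[OF assms \<open>x t \<in> X\<close>] derivative_in_tangent_cone[OF t]
      by blast
  qed
  then have "(AE t in lebesgue_on {0..<T}. \<exists>v\<in>projected_field X g f (x t).
        (x has_vector_derivative v) (at t within {0..<T}))
    \<longleftrightarrow> (AE t in lebesgue_on {0..<T}. \<exists>v\<in>krasovskii X (projected_field X g f) (x t).
        (x has_vector_derivative v) (at t within {0..<T}))"
    if "x \<in> {0..<T} \<rightarrow>\<^sub>E X" for x T
    using that by (intro AE_cong) simp
  then show ?thesis
    unfolding caratheodory_solutions_def krasovskii_solutions_def solutions_def by blast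
qed

end
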